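(* Let $m,n$ be positive integers with $m$ even, and let $\mathcal{A}^I=[\underline{\mathcal{A}},\overline{\mathcal{A}}]$ be a symmetric interval tensor in $T_{m,n}$ that is an interval B-tensor. Then $\mathcal{A}^I$ is an interval P-tensor.
   Context: $[n]=\{1,\dots,n\}$. $T_{m,n}$ is the set of real tensors $\mathcal{A}=(a_{i_1i_2\cdots i_m})$ with all indices in $[n]$. A tensor is symmetric if its entries are invariant under all permutations of their indices. For $\underline{\mathcal{A}}\le\overline{\mathcal{A}}$ in $T_{m,n}$ (entrywise), the interval tensor is $\mathcal{A}^I=[\underline{\mathcal{A}},\overline{\mathcal{A}}]=\{\mathcal{A}\in T_{m,n}:\underline{\mathcal{A}}\le\mathcal{A}\le\overline{\mathcal{A}}\}$. It is called symmetric if both $\mathcal{A}^c=\frac{1}{2}(\underline{\mathcal{A}}+\overline{\mathcal{A}})$ and $\Delta=\frac{1}{2}(\overline{\mathcal{A}}-\underline{\mathcal{A}})$ are symmetric tensors (members of $\mathcal{A}^I$ need not themselves be symmetric). B-tensor: $\mathcal{A}\in T_{m,n}$ is a B-tensor if for all $i_1\in[n]$: $\sum_{i_2,\dots,i_m=1}^n a_{i_1i_2\cdots i_m}>0$, and $\frac{1}{n^{m-1}}\sum_{i_2,\dots,i_m=1}^n a_{i_1i_2\cdots i_m}>a_{i_1j_2\cdots j_m}$ for all $(j_2,\dots,j_m)\in[n]^{m-1}$ with $(j_2,\dots,j_m)\neq(i_1,\dots,i_1)$. For $\mathbf{x}\in\mathbb{R}^n$, $\mathcal{A}\mathbf{x}^{m-1}\in\mathbb{R}^n$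 has components $(\mathcal{A}\mathbf{x}^{m-1})_i=\sum_{i_2,\dots,i_m=1}^n a_{ii_2\cdots i_m}x_{i_2}\cdots x_{i_m}$. $\mathcal{A}$ is a P-tensor if for every $\mathbf{x}\in\mathbb{R}^n\setminus\{\mathbf{0}\}$ there is $i\in[n]$ with $x_i^{m-1}(\mathcal{A}\mathbf{x}^{m-1})_i>0$. $\mathcal{A}^I$ is an interval B-tensor (resp. interval P-tensor) if every $\mathcal{A}\in\mathcal{A}^I$ is a B-tensor (resp. P-tensor). *)

theory Defs
  imports "HOL-Analysis.Analysis"
begin

text \<open>
  The index set \<open>[n]\<close> is a finite type \<open>'n\<close>, with \<open>n = CARD('n) \<ge> 1\<close>, and the multi-index
  \<open>(i\<^sub>1, \<dots>, i\<^sub>m)\<close> is the list \<open>[i\<^sub>1, \<dots>, i\<^sub>m]\<close>. The order \<open>m\<close> is a natural number, so that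
  its parity can be assumed.
\<close>

definition multi_indices :: "nat \<Rightarrow> 'n::finite list set" where
  "multi_indices k = {is. length is = k}"

lemma finite_multi_indices: "finite (multi_indices k)"
  using finite_lists_length_eq[of "UNIV :: 'n::finite set" k]
  by (simp add: multi_indices_def)

text \<open>
  A tensor takes the value \<open>undefined\<close> outside \<open>multi_indices m\<close>. Hence, for tensors of the same
  order, equality and the pointwise order \<open>\<le>\<close> of functions are entrywise.
\<close>

definition tensors :: "nat \<Rightarrow> ('n::finite list \<Rightarrow> real) set" where
  "tensors m = multi_indices m \<rightarrow>\<^sub>E UNIV"

definition symmetric_tensor :: "nat \<Rightarrow> ('n::finite list \<Rightarrow> real) \<Rightarrow> bool" where
  "symmetric_tensor m A \<longleftrightarrow>
     (\<forall>is\<in>multi_indices m. \<forall>p. p permutes {..<m} \<longrightarrow> A (permute_list p is) = A is)"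

definition interval_tensor ::
    "nat \<Rightarrow> ('n::finite list \<Rightarrow> real) \<Rightarrow> ('n list \<Rightarrow> real) \<Rightarrow> ('n list \<Rightarrow> real) set" where
  "interval_tensor m L U = {A \<in> tensors m. L \<le> A \<and> A \<le> U}"

definition midpoint_tensor ::
    "nat \<Rightarrow> ('n::finite list \<Rightarrow> real) \<Rightarrow> ('n list \<Rightarrow> real) \<Rightarrow> 'n list \<Rightarrow> real" where
  "midpoint_tensor m L U = (\<lambda>is\<in>multi_indices m. 1 / 2 * (L is + U is))"

definition radius_tensor ::
    "nat \<Rightarrow> ('n::finite list \<Rightarrow> real) \<Rightarrow> ('n list \<Rightarrow> real) \<Rightarrow> 'n list \<Rightarrow> real" where
  "radius_tensor m L U = (\<lambda>is\<in>multi_indices m. 1 / 2 * (U is - L is))"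

definition symmetric_interval_tensor ::
    "nat \<Rightarrow> ('n::finite list \<Rightarrow> real) \<Rightarrow> ('n list \<Rightarrow> real) \<Rightarrow> bool" where
  "symmetric_interval_tensor m L U \<longleftrightarrow>
     symmetric_tensor m (midpoint_tensor m L U) \<and> symmetric_tensor m (radius_tensor m L U)"

definition B_tensor :: "nat \<Rightarrow> ('n::finite list \<Rightarrow> real) \<Rightarrow> bool" where
  "B_tensor m A \<longleftrightarrow>
     (\<forall>i. (\<Sum>is\<in>multi_indices (m - 1). A (i # is)) > 0 \<and>
          (\<forall>js\<in>multi_indices (m - 1). js \<noteq> replicate (m - 1) i \<longrightarrow>
             1 / real CARD('n) ^ (m - 1) * (\<Sum>is\<in>multi_indices (m - 1). A (i # is)) > A (i # js)))"

definition tensor_apply :: "nat \<Rightarrow> ('n::finite list \<Rightarrow> real) \<Rightarrow> real ^ 'n \<Rightarrow> real ^ 'n" where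
  "tensor_apply m A x =
     (\<chi> i. \<Sum>is\<in>multi_indices (m - 1). A (i # is) * (\<Prod>j\<leftarrow>is. x $ j))"

definition P_tensor :: "nat \<Rightarrow> ('n::finite list \<Rightarrow> real) \<Rightarrow> bool" where
  "P_tensor m A \<longleftrightarrow> (\<forall>x. x \<noteq> 0 \<longrightarrow> (\<exists>i. (x $ i) ^ (m - 1) * tensor_apply m A x $ i > 0))"

definition interval_B_tensor ::
    "nat \<Rightarrow> ('n::finite list \<Rightarrow> real) \<Rightarrow> ('n list \<Rightarrow> real) \<Rightarrow> bool" where
  "interval_B_tensor m L U \<longleftrightarrow> (\<forall>A\<in>interval_tensor m L U. B_tensor m A)"

definition interval_P_tensor ::
    "nat \<Rightarrow> ('n::finite list \<Rightarrow> real) \<Rightarrow> ('n list \<Rightarrow> real) \<Rightarrow> bool" where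
  "interval_P_tensor m L U \<longleftrightarrow> (\<forall>A\<in>interval_tensor m L U. P_tensor m A)"

end

theory Submission
  imports Defs
begin

text \<open>
  The statement reduces, one vector at a time, to the positive definiteness of symmetric B-tensors
  of even order.

  Reduction. Fix \<open>A\<close> in the interval and \<open>x \<noteq> 0\<close>, and let \<open>V\<close> take its entry at
  \<open>is\<close> from \<open>L\<close> or from \<open>U\<close> according to the sign of the monomial of \<open>x\<close> at \<open>is\<close>, so
  that every term of \<open>A x\<^sup>m\<close> is at least the corresponding term of \<open>V x\<^sup>m\<close>. A
  monomial does not depend on the order of its factors, so \<open>V\<close> is symmetric although \<open>A\<close>
  need not be, and \<open>V\<close> is a B-tensor because it lies in the interval. If \<open>V x\<^sup>m > 0\<close>,
  then \<open>x\<^sub>i (V x\<^sup>m\<^sup>-\<^sup>1)\<^sub>i > 0\<close> for some \<open>i\<close>, hence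
  \<open>x\<^sub>i (A x\<^sup>m\<^sup>-\<^sup>1)\<^sub>i > 0\<close>, and multiplying by the even power
  \<open>x\<^sub>i\<^sup>m\<^sup>-\<^sup>2 > 0\<close> gives the P-property.

  Positive definiteness (\<open>symmetric_B_tensor_form_pos\<close>). Choose row bounds \<open>b\<^sub>i \<ge> 0\<close> that
  dominate the off-diagonal entries of row \<open>i\<close> but lie below the mean of the row. By symmetry an
  off-diagonal entry at \<open>is\<close> belongs, up to a permutation, to the row of each index in \<open>is\<close>,
  so it is at most the minimum \<open>C\<close> of \<open>b\<close> over \<open>is\<close>. Split \<open>A = M + C\<close>:
    \<^item> \<open>C x\<^sup>m\<close> is the integral over \<open>t \<ge> 0\<close> of the \<open>m\<close>-th power of the sum of those \<open>x\<^sub>j\<close>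
      with \<open>t \<le> b\<^sub>j\<close>, hence nonnegative (\<open>tensor_form_Min_nonneg\<close>);
    \<^item> \<open>M\<close> is symmetric with nonpositive off-diagonal entries and positive row sums, and the
      inequality of arithmetic and geometric means bounds \<open>M x\<^sup>m\<close> below by the sum of
      \<open>x\<^sub>i\<^sup>m\<close> weighted with the row sums (\<open>tensor_form_pos_if_Z_tensor_row_sums_pos\<close>).
\<close>

definition tensor_form :: "nat \<Rightarrow> ('n::finite list \<Rightarrow> real) \<Rightarrow> ('n \<Rightarrow> real) \<Rightarrow> real" where
  "tensor_form m A x = (\<Sum>is\<in>multi_indices m. A is * (\<Prod>j\<leftarrow>is. x j))"

section \<open>Sums over multi-indices\<close>

lemma multi_indices_0 [simp]: "multi_indices 0 = {[]}"
  by (auto simp: multi_indices_def)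

lemma Cons_in_multi_indices [simp]: "i # is \<in> multi_indices (Suc k) \<longleftrightarrow> is \<in> multi_indices k"
  by (auto simp: multi_indices_def)

lemma permute_list_in_multi_indices:
  "is \<in> multi_indices m \<Longrightarrow> permute_list p is \<in> multi_indices m"
  by (auto simp: multi_indices_def)

lemma card_multi_indices: "card (multi_indices k :: 'n::finite list set) = CARD('n) ^ k"
  using card_lists_length_eq[of "UNIV :: 'n set" k] by (simp add: multi_indices_def)

lemma sum_multi_indices_Suc:
  fixes f :: "'n::finite list \<Rightarrow> 'a::comm_monoid_add"
  shows "sum f (multi_indices (Suc k)) = (\<Sum>i\<in>UNIV. \<Sum>is\<in>multi_indices k. f (i # is))"
proof -
  have "(\<Sum>i\<in>UNIV. \<Sum>is\<in>multi_indices k. f (i # is))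
      = (\<Sum>(i, is)\<in>UNIV \<times> multi_indices k. f (i # is))"
    by (rule sum.cartesian_product)
  also have "\<dots> = sum f (multi_indices (Suc k))"
    by (rule sum.reindex_bij_witness[of _ "\<lambda>is. (hd is, tl is)" "\<lambda>(i, is). i # is"])
       (auto simp: multi_indices_def length_Suc_conv)
  finally show ?thesis by simp
qed

lemma power_sum_eq_sum_multi_indices:
  fixes y :: "'n::finite \<Rightarrow> real"
  shows "(\<Sum>j\<in>UNIV. y j) ^ k = (\<Sum>is\<in>multi_indices k. \<Prod>j\<leftarrow>is. y j)"
proof (induction k)
  case (Suc k)
  have "(\<Sum>j\<in>UNIV. y j) ^ Suc k = (\<Sum>i\<in>UNIV. y i) * (\<Sum>is\<in>multi_indices k. \<Prod>j\<leftarrow>is. y j)"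
    using Suc by simp
  also have "\<dots> = (\<Sum>i\<in>UNIV. \<Sum>is\<in>multi_indices k. y i * (\<Prod>j\<leftarrow>is. y j))"
    by (rule sum_product)
  finally show ?case by (simp add: sum_multi_indices_Suc)
qed simp

lemma tensor_form_eq_sum_tensor_apply:
  assumes "m > 0"
  shows "tensor_form m A (\<lambda>j. x $ j) = (\<Sum>i\<in>UNIV. x $ i * tensor_apply m A x $ i)"
proof -
  obtain k where m: "m = Suc k" using assms gr0_conv_Suc by auto
  show ?thesis
    by (simp add: m tensor_form_def tensor_apply_def sum_multi_indices_Suc sum_distrib_left
        algebra_simps)
qed

section \<open>Positive definiteness of symmetric B-tensors\<close>

text \<open>
  Transposing the slots \<open>0\<close> and \<open>k\<close> permutes the multi-indices and preserves the entries, so a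
  weight attached to slot \<open>k\<close> may be moved to slot \<open>0\<close>, where it factors out of each row sum.
\<close>

lemma symmetric_tensor_sum_slot:
  fixes A :: "'n::finite list \<Rightarrow> real"
  assumes sym: "symmetric_tensor m A" and k: "k < m"
  shows "(\<Sum>is\<in>multi_indices m. A is * g (is ! k))
       = (\<Sum>i\<in>UNIV. g i * (\<Sum>is\<in>multi_indices (m - 1). A (i # is)))"
proof -
  let ?p = "Transposition.transpose 0 k"
  have p: "?p permutes {..<m}" using k by (intro permutes_swap_id) auto
  have inv: "permute_list ?p (permute_list ?p is) = is" if "is \<in> multi_indices m" for "is" :: "'n list"
    using permute_list_compose[of ?p "is" ?p] p that by (simp add: multi_indices_def)
  have nth: "permute_list ?p is ! k = is ! 0" if "is \<in> multi_indices m" for "is" :: "'n list"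
    using permute_list_nth[of ?p "is" k] p that k by (simp add: multi_indices_def)
  obtain l where m: "m = Suc l" using k gr0_conv_Suc by (cases m) auto
  have "(\<Sum>is\<in>multi_indices m. A is * g (is ! k)) = (\<Sum>is\<in>multi_indices m. A is * g (is ! 0))"
  proof (rule sum.reindex_bij_witness[of _ "permute_list ?p" "permute_list ?p"])
    fix "is" :: "'n list" assume i: "is \<in> multi_indices m"
    show "A (permute_list ?p is) * g (permute_list ?p is ! 0) = A is * g (is ! k)"
      using sym p i inv nth[OF permute_list_in_multi_indices[OF i, of ?p]]
      by (simp add: symmetric_tensor_def)
  qed (auto intro: inv permute_list_in_multi_indices)
  then show ?thesis
    by (simp add: m sum_multi_indices_Suc sum_distrib_left algebra_simps)
qed

text \<open>
  The inequality of arithmetic and geometric means, applied to the \<open>m\<close>-th powers of the entries.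
  Evenness of \<open>m\<close> makes these powers nonnegative for entries of any sign.
\<close>

lemma prod_list_le_mean_power:
  fixes ys :: "real list"
  assumes "length ys = m" "m > 0" "even m"
  shows "prod_list ys \<le> (\<Sum>k<m. (ys ! k) ^ m) / m"
proof -
  have prod: "prod_list ys = (\<Prod>k<m. ys ! k)"
    using assms(1) by (simp add: prod.list_conv_set_nth atLeast0LessThan)
  have "(\<Prod>k<m. (ys ! k) ^ m) = \<bar>prod_list ys\<bar> ^ m"
    using \<open>even m\<close> by (simp add: prod prod_power_distrib power_even_abs)
  then have "(\<Prod>k<m. (ys ! k) ^ m) powr (1 / m) = \<bar>prod_list ys\<bar>"
    using \<open>m > 0\<close> by (cases "prod_list ys = 0") (simp_all add: powr_realpow[symmetric] powr_powr)
  moreover have "(\<Prod>k<m. (ys ! k) ^ m) powr (1 / m) \<le> (\<Sum>k<m. (ys ! k) ^ m / m)"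
    using arith_geom_mean[of "{..<m}" "\<lambda>k. (ys ! k) ^ m"] assms by (auto simp: zero_le_even_power)
  ultimately show ?thesis by (simp add: sum_divide_distrib)
qed

text \<open>
  Replacing each monomial by the mean of the \<open>m\<close>-th powers of its factors changes nothing on the
  diagonal and can only decrease the form elsewhere, since the mean
  is at least the monomial while the coefficient is nonpositive. After the replacement the form is
  diagonal, and by symmetry its coefficients are the row sums.
\<close>

lemma tensor_form_pos_if_Z_tensor_row_sums_pos:
  fixes M :: "'n::finite list \<Rightarrow> real"
  assumes m: "m > 0" "even m" and sym: "symmetric_tensor m M"
    and off: "\<And>is. is \<in> multi_indices m \<Longrightarrow> (\<And>i. is \<noteq> replicate m i) \<Longrightarrow> M is \<le> 0"
    and row: "\<And>i. (\<Sum>is\<in>multi_indices (m - 1). M (i # is)) > 0"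
    and x: "x j \<noteq> 0"
  shows "tensor_form m M x > 0"
proof -
  let ?r = "\<lambda>i. \<Sum>is\<in>multi_indices (m - 1). M (i # is)"
  have "0 < (\<Sum>i\<in>UNIV. x i ^ m * ?r i)"
  proof (rule sum_pos2[of _ j])
    show "0 < x j ^ m * ?r j" using row x m by (simp add: zero_less_power_eq)
    show "0 \<le> x i ^ m * ?r i" for i using less_imp_le[OF row] m by (simp add: zero_le_even_power)
  qed auto
  also have "\<dots> = (\<Sum>k<m. \<Sum>is\<in>multi_indices m. M is * x (is ! k) ^ m) / m"
    using symmetric_tensor_sum_slot[OF sym, of _ "\<lambda>i. x i ^ m"] m by simp
  also have "\<dots> = (\<Sum>is\<in>multi_indices m. M is * ((\<Sum>k<m. x (is ! k) ^ m) / m))"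
    by (subst sum.swap) (simp add: sum_divide_distrib sum_distrib_left)
  also have "\<dots> \<le> tensor_form m M x"
    unfolding tensor_form_def
  proof (rule sum_mono)
    fix "is" :: "'n list" assume i: "is \<in> multi_indices m"
    then have len: "length is = m" by (simp add: multi_indices_def)
    show "M is * ((\<Sum>k<m. x (is ! k) ^ m) / m) \<le> M is * (\<Prod>j\<leftarrow>is. x j)"
    proof (cases "\<exists>i. is = replicate m i")
      case True
      then show ?thesis using m by (auto simp: prod_list_replicate)
    next
      case False
      moreover have "(\<Prod>j\<leftarrow>is. x j) \<le> (\<Sum>k<m. x (is ! k) ^ m) / m"
        using prod_list_le_mean_power[of "map x is" m] m len by simp
      ultimately show ?thesis using off[OF i] by (intro mult_left_mono_neg) auto
    qed
  qed
  finally show ?thesis .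
qed

text \<open>
  For nonnegative \<open>b\<close>, the minimum of \<open>b\<close> over \<open>is\<close> is the integral over \<open>t \<ge> 0\<close> of the
  indicator that \<open>t \<le> b j\<close> for every \<open>j\<close> in \<open>is\<close>. This indicator is a product over \<open>is\<close>, so
  for each \<open>t\<close> the form is the \<open>m\<close>-th power of the linear form that sums \<open>x j\<close> over
  \<open>{j. t \<le> b j}\<close>, and \<open>m\<close> is even.
\<close>

lemma tensor_form_Min_nonneg:
  fixes b x :: "'n::finite \<Rightarrow> real"
  assumes m: "m > 0" "even m" and b: "\<And>i. b i \<ge> 0"
  shows "tensor_form m (\<lambda>is. Min (b ` set is)) x \<ge> 0"
proof -
  let ?B = "Max (range b)"
  let ?y = "\<lambda>t j. (if t \<le> b j then x j else 0)"
  have prod: "(\<Prod>j\<leftarrow>is. ?y t j) = (if \<forall>j\<in>set is. t \<le> b j then \<Prod>j\<leftarrow>is. x j else 0)" for t "is"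
    by (induction "is") auto
  have "((\<lambda>t. \<Prod>j\<leftarrow>is. ?y t j) has_integral (Min (b ` set is) * (\<Prod>j\<leftarrow>is. x j))) {0..?B}"
    if "is \<in> multi_indices m" for "is"
  proof -
    let ?c = "Min (b ` set is)"
    have ne: "set is \<noteq> {}" using that m by (auto simp: multi_indices_def)
    have c0: "0 \<le> ?c" using ne b by simp
    have "?c \<in> b ` set is" using ne by (intro Min_in) auto
    then have cB: "?c \<le> ?B" by (auto intro!: Max_ge)
    have "((\<lambda>t. if t \<in> {0..?c} then (\<Prod>j\<leftarrow>is. x j) else 0) has_integral (?c * (\<Prod>j\<leftarrow>is. x j))) {0..?B}"
      using has_integral_const_real[of "\<Prod>j\<leftarrow>is. x j" 0 ?c] c0 cB
      by (subst has_integral_restrict) (auto simp: content_real)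
    then show ?thesis
      by (rule has_integral_eq[rotated]) (use ne in \<open>auto simp: prod\<close>)
  qed
  then have "((\<lambda>t. \<Sum>is\<in>multi_indices m. \<Prod>j\<leftarrow>is. ?y t j) has_integral
      tensor_form m (\<lambda>is. Min (b ` set is)) x) {0..?B}"
    unfolding tensor_form_def by (intro has_integral_sum finite_multi_indices)
  then have "((\<lambda>t. (\<Sum>j\<in>UNIV. ?y t j) ^ m) has_integral
      tensor_form m (\<lambda>is. Min (b ` set is)) x) {0..?B}"
    by (simp only: power_sum_eq_sum_multi_indices)
  then show ?thesis
    by (rule has_integral_nonneg) (simp add: m zero_le_even_power)
qed

text \<open>
  The two conditions on a row say that its mean exceeds \<open>0\<close> and every off-diagonal entry; as there
  are finitely many of these numbers, their maximum is a bound. Taking the mean itself as the bound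
  would lose the strictness on which the positive row sums of \<open>A - C\<close> rest.
\<close>

lemma B_tensor_obtain_row_bounds:
  fixes A :: "'n::finite list \<Rightarrow> real"
  assumes "B_tensor m A"
  obtains b where "\<And>i. b i \<ge> 0"
    and "\<And>i js. js \<in> multi_indices (m - 1) \<Longrightarrow> js \<noteq> replicate (m - 1) i \<Longrightarrow> A (i # js) \<le> b i"
    and "\<And>i. real CARD('n) ^ (m - 1) * b i < (\<Sum>is\<in>multi_indices (m - 1). A (i # is))"
proof
  let ?J = "\<lambda>i. multi_indices (m - 1) - {replicate (m - 1) i}"
  let ?b = "\<lambda>i. Max (insert 0 ((\<lambda>js. A (i # js)) ` ?J i))"
  have fin: "finite (insert 0 ((\<lambda>js. A (i # js)) ` ?J i))" for i
    by (simp add: finite_multi_indices)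
  show "?b i \<ge> 0" for i using fin by (intro Max_ge) auto
  show "A (i # js) \<le> ?b i" if "js \<in> multi_indices (m - 1)" "js \<noteq> replicate (m - 1) i" for i js
    using fin that by (intro Max_ge) auto
  show "real CARD('n) ^ (m - 1) * ?b i < (\<Sum>is\<in>multi_indices (m - 1). A (i # is))" for i
  proof -
    have "?b i \<in> insert 0 ((\<lambda>js. A (i # js)) ` ?J i)" using fin by (intro Max_in) auto
    then consider "?b i = 0"
      | js where "js \<in> multi_indices (m - 1)" "js \<noteq> replicate (m - 1) i" "?b i = A (i # js)"
      by blast
    then show ?thesis
    proof cases
      case 1
      then show ?thesis using assms by (simp add: B_tensor_def)
    next
      case 2
      then have "?b i < 1 / real CARD('n) ^ (m - 1) * (\<Sum>is\<in>multi_indices (m - 1). A (i # is))"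
        using assms by (simp add: B_tensor_def)
      then show ?thesis by (simp add: field_simps)
    qed
  qed
qed

text \<open>
  Subtracting a single bound from each
  row would destroy symmetry; the minimum of the bounds over the whole multi-index is symmetric,
  still dominates the off-diagonal entries, and is small enough to keep the row sums positive.
\<close>

lemma symmetric_B_tensor_form_pos:
  fixes A :: "'n::finite list \<Rightarrow> real"
  assumes m: "m > 0" "even m" and sym: "symmetric_tensor m A" and B: "B_tensor m A"
    and x: "x j \<noteq> 0"
  shows "tensor_form m A x > 0"
proof -
  obtain b where b0: "\<And>i. b i \<ge> 0"
    and boff: "\<And>i js. js \<in> multi_indices (m - 1) \<Longrightarrow> js \<noteq> replicate (m - 1) i \<Longrightarrow> A (i # js) \<le> b i"
    and brow: "\<And>i. real CARD('n) ^ (m - 1) * b i < (\<Sum>is\<in>multi_indices (m - 1). A (i # is))"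
    using B_tensor_obtain_row_bounds[OF B] by blast
  define C where "C = (\<lambda>is. Min (b ` set is))"
  define M where "M = (\<lambda>is. A is - C is)"
  have "tensor_form m M x > 0"
  proof (rule tensor_form_pos_if_Z_tensor_row_sums_pos[OF m])
    show "symmetric_tensor m M"
      using sym by (auto simp: symmetric_tensor_def M_def C_def multi_indices_def)
  next
    fix "is" :: "'n list"
    assume i: "is \<in> multi_indices m" and nc: "\<And>i. is \<noteq> replicate m i"
    have len: "length is = m" using i by (simp add: multi_indices_def)
    \<comment> \<open>Moving slot \<open>k\<close> to the front exhibits the entry as an off-diagonal entry of row \<open>is ! k\<close>.\<close>
    have "A is \<le> b (is ! k)" if k: "k < m" for k
    proof -
      let ?p = "Transposition.transpose 0 k"
      have p: "?p permutes {..<m}" using k by (intro permutes_swap_id) auto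
      obtain j js where js: "permute_list ?p is = j # js"
        using len m by (cases "permute_list ?p is") (auto dest: arg_cong[of _ _ length])
      have j: "j = is ! k"
        using permute_list_nth[of ?p "is" 0] p len m js by simp
      have ljs: "length js = m - 1"
        using js len by (metis length_permute_list length_tl list.sel(3))
      have "js \<noteq> replicate (m - 1) j"
      proof
        assume "js = replicate (m - 1) j"
        then have "set (permute_list ?p is) = {j}" using js by auto
        then have "set is = {j}" using p len by simp
        then have "is = replicate m j" using len by (metis replicate_eqI singletonD)
        with nc show False by blast
      qed
      then have "A (j # js) \<le> b j" using boff ljs by (simp add: multi_indices_def)
      moreover have "A (j # js) = A is"
        using sym p i js by (metis symmetric_tensor_def)
      ultimately show ?thesis using j by simp
    qed
    then have "A is \<le> C is"
      unfolding C_def using len m by (subst Min_ge_iff) (auto simp: in_set_conv_nth)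
    then show "M is \<le> 0" by (simp add: M_def)
  next
    fix i
    have "(\<Sum>is\<in>multi_indices (m - 1). C (i # is)) \<le> (\<Sum>is\<in>(multi_indices (m - 1) :: 'n list set). b i)"
      by (intro sum_mono) (simp add: C_def)
    also have "\<dots> = real CARD('n) ^ (m - 1) * b i"
      by (simp add: card_multi_indices)
    finally show "(\<Sum>is\<in>multi_indices (m - 1). M (i # is)) > 0"
      using brow[of i] by (simp add: M_def sum_subtractf)
  qed (rule x)
  moreover have "tensor_form m C x \<ge> 0"
    unfolding C_def using m b0 by (rule tensor_form_Min_nonneg)
  moreover have "tensor_form m A x = tensor_form m M x + tensor_form m C x"
    by (simp add: tensor_form_def M_def algebra_simps sum.distrib[symmetric])
  ultimately show ?thesis by simp
qed

section \<open>Reduction to a symmetric member of the interval\<close>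

lemma symmetric_interval_tensor_endpoints:
  assumes "symmetric_interval_tensor m L U"
  shows "symmetric_tensor m L" and "symmetric_tensor m U"
proof -
  have "L (permute_list p is) = L is \<and> U (permute_list p is) = U is"
    if i: "is \<in> multi_indices m" and p: "p permutes {..<m}" for p "is"
  proof -
    have "L (permute_list p is) + U (permute_list p is) = L is + U is"
      and "U (permute_list p is) - L (permute_list p is) = U is - L is"
      using assms[unfolded symmetric_interval_tensor_def symmetric_tensor_def
          midpoint_tensor_def radius_tensor_def] i p permute_list_in_multi_indices[OF i, of p]
      by force+
    then show ?thesis by linarith
  qed
  then show "symmetric_tensor m L" and "symmetric_tensor m U"
    by (auto simp: symmetric_tensor_def)
qed

theorem corollary3p7:
  fixes m :: nat and L U :: "'n::finite list \<Rightarrow> real"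
  assumes "m > 0" and "even m"
    and "L \<in> tensors m" and "U \<in> tensors m" and "L \<le> U"
    and "symmetric_interval_tensor m L U"
    and "interval_B_tensor m L U"
  shows "interval_P_tensor m L U"
  unfolding interval_P_tensor_def P_tensor_def
proof (intro ballI allI impI)
  fix A and x :: "real ^ 'n"
  assume A: "A \<in> interval_tensor m L U" and x: "x \<noteq> 0"
  \<comment> \<open>\<open>V\<close> minimizes every term of the form at \<open>x\<close> over the interval.\<close>
  define V where "V is = (if (\<Prod>j\<leftarrow>is. x $ j) \<ge> 0 then L is else U is)" for "is"
  have "V \<in> interval_tensor m L U"
    using assms(3-5) by (auto simp: interval_tensor_def V_def tensors_def le_fun_def PiE_iff extensional_def)
  then have "B_tensor m V" using assms(7) by (simp add: interval_B_tensor_def)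
  moreover have "symmetric_tensor m V"
  proof -
    have "(\<Prod>j\<leftarrow>permute_list p is. x $ j) = (\<Prod>j\<leftarrow>is. x $ j)"
      if "is \<in> multi_indices m" "p permutes {..<m}" for p "is"
      using that mset_permute_list[of p "is"]
      by (metis (mono_tags, lifting) mem_Collect_eq mset_map multi_indices_def prod_mset_prod_list)
    then show ?thesis
      using symmetric_interval_tensor_endpoints[OF assms(6)]
      by (auto simp: symmetric_tensor_def V_def)
  qed
  moreover obtain j where "x $ j \<noteq> 0" using x by (auto simp: vec_eq_iff)
  ultimately have "0 < tensor_form m V (\<lambda>j. x $ j)"
    using assms(1,2) symmetric_B_tensor_form_pos[of m V "\<lambda>j. x $ j" j] by simp
  then have "0 < (\<Sum>i\<in>UNIV. x $ i * tensor_apply m V x $ i)"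
    using assms(1) by (simp add: tensor_form_eq_sum_tensor_apply)
  then obtain i where i: "0 < x $ i * tensor_apply m V x $ i"
    by (meson not_le sum_nonpos)
  have "x $ i * tensor_apply m V x $ i \<le> x $ i * tensor_apply m A x $ i"
  proof -
    have "V is * (\<Prod>j\<leftarrow>is. x $ j) \<le> A is * (\<Prod>j\<leftarrow>is. x $ j)" for "is"
      using A by (auto simp: V_def interval_tensor_def le_fun_def intro: mult_right_mono mult_right_mono_neg)
    from this[of "i # _"] show ?thesis
      by (auto simp: tensor_apply_def sum_distrib_left algebra_simps intro!: sum_mono)
  qed
  with i have pos: "0 < x $ i * tensor_apply m A x $ i" by linarith
  moreover have "(x $ i) ^ (m - 1) * tensor_apply m A x $ i
      = (x $ i) ^ (m - 2) * (x $ i * tensor_apply m A x $ i)"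
  proof -
    have "m - 1 = Suc (m - 2)" using assms(1,2) by (cases m) auto
    then show ?thesis by simp
  qed
  moreover have "(x $ i) ^ (m - 2) > 0"
    using assms(2) pos by (auto simp: zero_less_power_eq)
  ultimately show "\<exists>i. 0 < (x $ i) ^ (m - 1) * tensor_apply m A x $ i"
    by (metis mult_pos_pos)
qed

end
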